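(* Let $q$ be admissible (in dimension $d=2$) and let $\eta>1$. Then there exist nonempty compact convex sets $\Theta_S\subsetneq\Theta_L\subseteq\mathbb{R}^2$ and $\sigma_1<\infty$ such that $$\sup_{\theta\in\Theta_S}R_\sigma^{(q,\eta)}(\theta;\Theta_S)>\sup_{\theta\in\Theta_L}R_\sigma^{(q,\eta)}(\theta;\Theta_L)$$ for all $\sigma\ge\sigma_1$.
   Context: A function $q:[0,\infty)\to(0,\infty)$ is called admissible (in dimension $d$) if it is strictly decreasing and $0<C_q:=\int_{\mathbb{R}^d}q(\|w\|)\,dw<\infty$; here $d=2$. For admissible $q$, $W_q$ is an $\mathbb{R}^d$-valued random vector with density $f_q(w)=C_q^{-1}q(\|w\|)$. For a nonempty compact convex set $\Theta$, $\Pi_\Theta(y)=\arg\min_{\theta\in\Theta}\|y-\theta\|^2$ is the Euclidean projection. For $\sigma>0$, $\eta>0$ and $\theta\in\Theta$, the radial risk is $R_\sigma^{(q,\eta)}(\theta;\Theta)=\mathbb{E}\,\frac1\eta\|\Pi_\Theta(\theta+\sigma W_q)-\theta\|^\eta$. *)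

theory Defs
  imports "HOL-Probability.Probability"
begin

text \<open>
  The dimension is carried by the ambient Euclidean space, passed as a type argument where it
  cannot be inferred. A profile is a total function on the reals of which only the restriction to
  the nonnegative half-line matters.
\<close>

definition radial_mass :: "'a::euclidean_space itself \<Rightarrow> (real \<Rightarrow> real) \<Rightarrow> real" where
  "radial_mass _ q = (LINT w::'a|lborel. q (norm w))"

definition admissible :: "'a::euclidean_space itself \<Rightarrow> (real \<Rightarrow> real) \<Rightarrow> bool" where
  "admissible T q \<longleftrightarrow>
     (\<forall>r\<ge>0. q r > 0) \<and>
     strict_antimono_on {0..} q \<and>
     integrable lborel (\<lambda>w::'a. q (norm w)) \<and>
     radial_mass T q > 0"

definition radial_density :: "(real \<Rightarrow> real) \<Rightarrow> 'a::euclidean_space \<Rightarrow> real" where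
  "radial_density q w = q (norm w) / radial_mass TYPE('a) q"

text \<open>The law of the noise vector; expectations of functions of the noise are integrals against it.\<close>

definition radial_law :: "(real \<Rightarrow> real) \<Rightarrow> 'a::euclidean_space measure" where
  "radial_law q = density lborel (\<lambda>w. ennreal (radial_density q w))"

text \<open>
  \<^const>\<open>closest_point\<close> is the Euclidean projection: for a nonempty closed convex set
  the minimiser it picks is unique.
\<close>

definition radial_risk ::
  "(real \<Rightarrow> real) \<Rightarrow> real \<Rightarrow> real \<Rightarrow> 'a::euclidean_space set \<Rightarrow> 'a \<Rightarrow> real" where
  "radial_risk q \<eta> \<sigma> \<Theta> \<theta> =
     (LINT w|radial_law q.
        (1 / \<eta>) * norm (closest_point \<Theta> (\<theta> + \<sigma> *\<^sub>R w) - \<theta>) powr \<eta>)"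

lemma prob_space_radial_law:
  assumes "admissible TYPE('a::euclidean_space) q"
  shows "prob_space (radial_law q :: 'a measure)"
proof
  have int: "integrable lborel (\<lambda>w::'a. q (norm w))" and C: "radial_mass TYPE('a) q > 0"
    and pos: "\<And>w::'a. q (norm w) > 0"
    using assms by (auto simp: admissible_def)
  have int': "integrable lborel (radial_density q :: 'a \<Rightarrow> real)"
    using int unfolding radial_density_def by simp
  have "emeasure (radial_law q :: 'a measure) (space (radial_law q))
      = (\<integral>\<^sup>+ w. ennreal (radial_density q (w::'a)) \<partial>lborel)"
    using borel_measurable_integrable[OF int']
    by (simp add: radial_law_def emeasure_density)
  also have "\<dots> = ennreal (LINT w::'a|lborel. radial_density q w)"
    using int' pos C by (intro nn_integral_eq_integral AE_I2) (assumption, simp add: radial_density_def less_imp_le)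
  also have "(LINT w::'a|lborel. radial_density q w) = 1"
    using C by (simp add: radial_density_def radial_mass_def)
  finally show "emeasure (radial_law q :: 'a measure) (space (radial_law q)) = 1" by simp
qed

text \<open>
  The integrand of the risk is integrable and the risk is bounded on the parameter set, so the real
  integral and the real supremum over the parameter set never take default values.
\<close>

lemma radial_risk_well_defined:
  fixes \<Theta> :: "'a::euclidean_space set"
  assumes q: "admissible TYPE('a) q" and \<Theta>: "\<Theta> \<noteq> {}" "compact \<Theta>" "convex \<Theta>" and \<eta>: "\<eta> > 0"
  shows "\<theta> \<in> \<Theta> \<Longrightarrow> integrable (radial_law q)
           (\<lambda>w. (1 / \<eta>) * norm (closest_point \<Theta> (\<theta> + \<sigma> *\<^sub>R w) - \<theta>) powr \<eta>)"
    and "bdd_above (radial_risk q \<eta> \<sigma> \<Theta> ` \<Theta>)"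
proof -
  interpret prob_space "radial_law q :: 'a measure" by (rule prob_space_radial_law[OF q])
  let ?B = "(1 / \<eta>) * diameter \<Theta> powr \<eta>"
  have cl: "closed \<Theta>" using \<Theta> by (simp add: compact_imp_closed)
  have bnd: "(1 / \<eta>) * norm (closest_point \<Theta> y - \<theta>) powr \<eta> \<le> ?B" if "\<theta> \<in> \<Theta>" for \<theta> y
  proof -
    have "norm (closest_point \<Theta> y - \<theta>) \<le> diameter \<Theta>"
      using diameter_bounded_bound[OF compact_imp_bounded[OF \<Theta>(2)] closest_point_in_set[OF cl \<Theta>(1)] that]
      by (simp add: dist_norm)
    then show ?thesis using \<eta> by (intro mult_left_mono powr_mono2) auto
  qed
  show int: "integrable (radial_law q)
           (\<lambda>w. (1 / \<eta>) * norm (closest_point \<Theta> (\<theta> + \<sigma> *\<^sub>R w) - \<theta>) powr \<eta>)"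
    if "\<theta> \<in> \<Theta>" for \<theta>
  proof (rule integrable_const_bound[where B = ?B])
    show "AE w in radial_law q.
        norm ((1 / \<eta>) * norm (closest_point \<Theta> (\<theta> + \<sigma> *\<^sub>R w) - \<theta>) powr \<eta>) \<le> ?B"
      using bnd[OF that] \<eta> by simp
    have "continuous_on UNIV (\<lambda>w. closest_point \<Theta> (\<theta> + \<sigma> *\<^sub>R w))"
      by (rule continuous_on_compose2[OF continuous_on_closest_point[OF \<Theta>(3) cl \<Theta>(1), of UNIV]])
         (auto intro!: continuous_intros)
    then have [measurable]: "(\<lambda>w. closest_point \<Theta> (\<theta> + \<sigma> *\<^sub>R w)) \<in> borel_measurable borel"
      by (rule borel_measurable_continuous_onI)
    show "(\<lambda>w. (1 / \<eta>) * norm (closest_point \<Theta> (\<theta> + \<sigma> *\<^sub>R w) - \<theta>) powr \<eta>)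
        \<in> borel_measurable (radial_law q)"
      unfolding radial_law_def by measurable
  qed
  show "bdd_above (radial_risk q \<eta> \<sigma> \<Theta> ` \<Theta>)"
  proof (rule bdd_aboveI2)
    fix \<theta> assume "\<theta> \<in> \<Theta>"
    have "expectation (\<lambda>w. (1 / \<eta>) * norm (closest_point \<Theta> (\<theta> + \<sigma> *\<^sub>R w) - \<theta>) powr \<eta>) \<le> ?B"
      using bnd[OF \<open>\<theta> \<in> \<Theta>\<close>] by (intro integral_le_const int[OF \<open>\<theta> \<in> \<Theta>\<close>]) simp
    then show "radial_risk q \<eta> \<sigma> \<Theta> \<theta> \<le> ?B" by (simp add: radial_risk_def)
  qed
qed

end

theory Submission
  imports Defs
begin

text \<open>
  When the noise level is large, the projection of a noisy point onto a polytope is almost always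
  a vertex, and which vertex it is depends only on the normal cone in which the noise vector lies.
  So, uniformly over the parameter, the risk converges to a weighted sum of
  \<open>\<parallel>v - \<theta>\<parallel>\<^sup>\<eta> / \<eta>\<close> over the vertices \<open>v\<close>, the weights being the
  probabilities of the normal cones (\<open>uniform_limit_radial_risk\<close>). The limit is convex in the
  parameter, so it is largest at a vertex (\<open>limit_risk_le_of_vertices\<close>).

  Compare the segment from \<open>-e\<close> to \<open>e\<close>, where \<open>e\<close> is a unit vector, with the isosceles
  triangle obtained by adding an apex \<open>h f\<close> on the perpendicular axis. At an end of the segment,
  half of the noise leads to the opposite end, at distance \<open>2\<close>, so the limiting risk there is
  \<open>2\<^sup>\<eta>\<^sup>-\<^sup>1 / \<eta>\<close>. In the triangle, the apex takes over a positive share \<open>p\<close> of the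
  noise. By the symmetry of the noise and of the triangle under \<open>e \<mapsto> -e\<close>, half of that share
  is taken from each end. At a base vertex, noise that used to cost \<open>2\<^sup>\<eta>\<close> or \<open>0\<close>, on average
  \<open>2\<^sup>\<eta>\<^sup>-\<^sup>1\<close>, now costs \<open>(1 + h\<^sup>2)\<^sup>\<eta>\<^sup>/\<^sup>2\<close>
  (all up to the factor \<open>1 / \<eta>\<close>). For \<open>\<eta> > 1\<close> and small \<open>h\<close> this is a
  strict gain. The risk at the apex is also at most \<open>(1 + h\<^sup>2)\<^sup>\<eta>\<^sup>/\<^sup>2 / \<eta>\<close>
  (\<open>limit_risk_segment\<close>, \<open>limit_risk_triangle\<close>). Uniform convergence carries the strict
  inequality between the two suprema over to all large noise levels.
\<close>

section \<open>Projection onto a polytope\<close>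

text \<open>
  The interior of the normal cone of the convex hull of a finite set \<open>V\<close> at its point \<open>v\<close>. Being
  phrased with the points of \<open>V\<close> only, it is a finite intersection of half-spaces, and it is empty
  when \<open>V\<close> has other points and \<open>v\<close> is not a vertex.
\<close>
definition open_normal_cone :: "'a::real_inner set \<Rightarrow> 'a \<Rightarrow> 'a set" where
  "open_normal_cone V v = {w. \<forall>u\<in>V - {v}. w \<bullet> (u - v) < 0}"

text \<open>
  The directions that single out \<open>v\<close> with a margin. The margin absorbs the displacement of the
  starting point in \<open>closest_point_deep_normal_cone\<close>.
\<close>
definition deep_normal_cone :: "'a::real_inner set \<Rightarrow> real \<Rightarrow> 'a \<Rightarrow> 'a set" where
  "deep_normal_cone V c v = {w. \<forall>u\<in>V - {v}. w \<bullet> (u - v) \<le> - c}"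

lemma open_open_normal_cone:
  assumes "finite V"
  shows "open (open_normal_cone V v)"
proof -
  have "open_normal_cone V v = (\<Inter>u\<in>V - {v}. {w. w \<bullet> (u - v) < 0})"
    by (auto simp: open_normal_cone_def)
  moreover have "open \<dots>"
    using assms by (intro open_INT ballI open_Collect_less continuous_intros) auto
  ultimately show ?thesis by simp
qed

lemma closed_deep_normal_cone: "closed (deep_normal_cone V c v)"
proof -
  have "deep_normal_cone V c v = (\<Inter>u\<in>V - {v}. {w. w \<bullet> (u - v) \<le> - c})"
    by (auto simp: deep_normal_cone_def)
  moreover have "closed \<dots>"
    by (intro closed_INT ballI closed_Collect_le continuous_intros)
  ultimately show ?thesis by simp
qed

lemma deep_normal_cone_subset_open:
  "c > 0 \<Longrightarrow> deep_normal_cone V c v \<subseteq> open_normal_cone V v"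
  by (force simp: deep_normal_cone_def open_normal_cone_def)

lemma deep_normal_cone_antimono:
  "c \<le> d \<Longrightarrow> deep_normal_cone V d v \<subseteq> deep_normal_cone V c v"
  by (force simp: deep_normal_cone_def)

lemma open_normal_cone_disjoint:
  assumes "w \<in> open_normal_cone V u" "w \<in> open_normal_cone V v" "u \<in> V" "v \<in> V"
  shows "u = v"
proof (rule ccontr)
  assume "u \<noteq> v"
  then have "w \<bullet> (v - u) < 0" "w \<bullet> (u - v) < 0"
    using assms by (auto simp: open_normal_cone_def)
  then show False by (simp add: inner_diff_right)
qed

lemma sum_indicator_open_normal_cone:
  fixes f :: "'a::real_inner \<Rightarrow> real"
  assumes "finite V" "v \<in> V" "w \<in> open_normal_cone V v"
  shows "(\<Sum>u\<in>V. indicator (open_normal_cone V u) w * f u) = f v"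
proof -
  have "(\<Sum>u\<in>V. indicator (open_normal_cone V u) w * f u) = (\<Sum>u\<in>V. if u = v then f v else 0)"
    using assms open_normal_cone_disjoint by (intro sum.cong) (auto simp: indicator_def)
  then show ?thesis using assms by simp
qed

text \<open>
  A linear functional that separates the points of \<open>V\<close> is maximised over \<open>V\<close> at one point only.
\<close>
lemma open_normal_cones_cover:
  assumes "finite V" "V \<noteq> {}" "\<And>u v. u \<in> V \<Longrightarrow> v \<in> V \<Longrightarrow> u \<noteq> v \<Longrightarrow> w \<bullet> (u - v) \<noteq> 0"
  shows "\<exists>v\<in>V. w \<in> open_normal_cone V v"
proof -
  have "Max ((\<lambda>v. w \<bullet> v) ` V) \<in> (\<lambda>v. w \<bullet> v) ` V"
    using assms by (intro Max_in) auto
  then obtain v where v: "v \<in> V" "w \<bullet> v = Max ((\<lambda>v. w \<bullet> v) ` V)" by auto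
  have "w \<bullet> (u - v) < 0" if "u \<in> V - {v}" for u
  proof -
    have "w \<bullet> u \<le> w \<bullet> v" using v that assms(1) by simp
    with assms(3)[of u v] v that show ?thesis by (simp add: inner_diff_right)
  qed
  with v show ?thesis by (auto simp: open_normal_cone_def)
qed

text \<open>
  The variational inequality for the projection is linear in the competitor, hence it suffices to
  test it on the generating points.
\<close>
lemma closest_point_convex_hull_vertex:
  fixes V :: "'a::euclidean_space set"
  assumes "finite V" "v \<in> V" "\<And>u. u \<in> V \<Longrightarrow> (y - v) \<bullet> (u - v) \<le> 0"
  shows "closest_point (convex hull V) y = v"
proof -
  have sub: "convex hull V \<subseteq> {z. (y - v) \<bullet> z \<le> (y - v) \<bullet> v}"
    using assms(3) by (intro hull_minimal convex_halfspace_le) (auto simp: inner_diff_right)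
  have "dist y v \<le> dist y z" if "z \<in> convex hull V" for z
  proof -
    have "(y - v) \<bullet> (z - v) \<le> 0" using sub that by (auto simp: inner_diff_right)
    moreover have "(y - z) \<bullet> (y - z) = (y - v) \<bullet> (y - v) - 2 * ((y - v) \<bullet> (z - v)) + (z - v) \<bullet> (z - v)"
      by (simp add: inner_diff_left inner_diff_right inner_commute algebra_simps)
    ultimately show ?thesis
      using inner_ge_zero[of "z - v"] unfolding dist_norm norm_le by linarith
  qed
  then have "v = closest_point (convex hull V) y"
    using assms by (intro closest_point_unique)
      (auto intro: hull_inc compact_imp_closed finite_imp_compact_convex_hull)
  then show ?thesis by simp
qed

text \<open>
  The starting point \<open>\<theta>\<close> contributes at most \<open>D\<^sup>2\<close> to the variational inequality by
  Cauchy--Schwarz, whereas the noise contributes \<open>-D\<^sup>2\<close> or less. The required margin is the same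
  for all \<open>\<theta>\<close>, which is what makes the convergence of the risk uniform.
\<close>
lemma closest_point_deep_normal_cone:
  fixes V :: "'a::euclidean_space set"
  assumes V: "finite V" "v \<in> V" and \<theta>: "\<theta> \<in> convex hull V" and "\<sigma> > 0"
    and D: "\<And>x y. x \<in> convex hull V \<Longrightarrow> y \<in> convex hull V \<Longrightarrow> norm (x - y) \<le> D"
    and w: "w \<in> deep_normal_cone V (D\<^sup>2 / \<sigma>) v"
  shows "closest_point (convex hull V) (\<theta> + \<sigma> *\<^sub>R w) = v"
proof (rule closest_point_convex_hull_vertex[OF V])
  fix u assume "u \<in> V"
  show "(\<theta> + \<sigma> *\<^sub>R w - v) \<bullet> (u - v) \<le> 0"
  proof (cases "u = v")
    case False
    have n: "norm (\<theta> - v) \<le> D" "norm (u - v) \<le> D"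
      using V \<theta> \<open>u \<in> V\<close> by (auto intro!: D hull_inc)
    have "(\<theta> - v) \<bullet> (u - v) \<le> norm (\<theta> - v) * norm (u - v)"
      by (rule norm_cauchy_schwarz)
    also have "\<dots> \<le> D\<^sup>2"
      using n unfolding power2_eq_square by (intro mult_mono) (auto intro: order_trans[OF norm_ge_zero])
    finally have "(\<theta> - v) \<bullet> (u - v) \<le> D\<^sup>2" .
    moreover have "\<sigma> * (w \<bullet> (u - v)) \<le> - D\<^sup>2"
      using w False \<open>u \<in> V\<close> \<open>\<sigma> > 0\<close> by (auto simp: deep_normal_cone_def field_simps)
    moreover have "(\<theta> + \<sigma> *\<^sub>R w - v) \<bullet> (u - v) = (\<theta> - v) \<bullet> (u - v) + \<sigma> * (w \<bullet> (u - v))"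
      by (simp add: inner_diff_left inner_add_left)
    ultimately show ?thesis by linarith
  qed simp
qed

section \<open>The noise law\<close>

lemma radial_density_measurable:
  assumes "admissible TYPE('a::euclidean_space) q"
  shows "(radial_density q :: 'a \<Rightarrow> real) \<in> borel_measurable borel"
proof -
  have "(\<lambda>w::'a. q (norm w)) \<in> borel_measurable borel"
    using assms borel_measurable_integrable by (fastforce simp: admissible_def)
  then show ?thesis unfolding radial_density_def by simp
qed

lemma sets_radial_law [measurable_cong, simp]: "sets (radial_law q) = sets borel"
  by (simp add: radial_law_def)

lemma space_radial_law [simp]: "space (radial_law q) = UNIV"
  by (simp add: radial_law_def)

lemma AE_radial_law_not_orthogonal:
  fixes a :: "'a::euclidean_space"
  assumes "admissible TYPE('a) q" "a \<noteq> 0"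
  shows "AE w in radial_law q. w \<bullet> a \<noteq> 0"
proof -
  have "{w. a \<bullet> w = 0} \<in> null_sets lborel"
    using negligible_hyperplane[of a 0] assms(2) closed_hyperplane[of a 0]
    by (simp add: negligible_iff_null_sets null_sets_completion_iff)
  then have "AE w in lborel. w \<notin> {w. a \<bullet> w = 0}" by (rule AE_not_in)
  then have "AE w in lborel. w \<bullet> a \<noteq> 0" by (simp add: inner_commute)
  then show ?thesis
    unfolding radial_law_def
    using radial_density_measurable[OF assms(1)] by (subst AE_density) auto
qed

lemma radial_law_open_pos:
  fixes U :: "'a::euclidean_space set"
  assumes q: "admissible TYPE('a) q" and U: "open U" "U \<noteq> {}"
  shows "measure (radial_law q) U > 0"
proof -
  interpret prob_space "radial_law q :: 'a measure" by (rule prob_space_radial_law[OF q])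
  have pos: "radial_density q w > 0" for w :: 'a
    using q by (simp add: radial_density_def admissible_def)
  have "measure (radial_law q) U \<noteq> 0"
  proof
    assume "measure (radial_law q) U = 0"
    then have "U \<in> null_sets (radial_law q)"
      using U by (intro null_setsI) (auto simp: emeasure_eq_measure)
    then have "AE w in lborel. w \<in> U \<longrightarrow> ennreal (radial_density q w) = 0"
      unfolding radial_law_def using radial_density_measurable[OF q]
      by (subst (asm) null_sets_density_iff) auto
    then have "AE w in lborel. w \<notin> U"
      using pos by (auto simp: ennreal_eq_0_iff not_le[symmetric] elim!: eventually_mono)
    then have "U \<in> null_sets lborel"
      using U by (simp add: AE_iff_null_sets)
    then have "negligible U"
      by (simp add: negligible_iff_null_sets null_sets_completionI)
    then show False using open_not_negligible U by blast
  qed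
  then show ?thesis using measure_nonneg[of "radial_law q" U] by linarith
qed

text \<open>
  Only one reflection is needed to compare the two ends of the base, and a coordinate reflection
  preserves Lebesgue measure by the formula for diagonal affine maps.
\<close>
definition coord_reflection :: "'a::real_inner \<Rightarrow> 'a \<Rightarrow> 'a" where
  "coord_reflection e w = w - (2 * (w \<bullet> e)) *\<^sub>R e"

lemma coord_reflection_inner:
  "norm e = 1 \<Longrightarrow> coord_reflection e x \<bullet> coord_reflection e y = x \<bullet> y"
  by (simp add: coord_reflection_def inner_diff_left inner_diff_right inner_commute
      dot_square_norm algebra_simps)

lemma coord_reflection_diff: "coord_reflection e (x - y) = coord_reflection e x - coord_reflection e y"
  by (simp add: coord_reflection_def inner_diff_left algebra_simps)

lemma coord_reflection_involution: "norm e = 1 \<Longrightarrow> coord_reflection e (coord_reflection e x) = x"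
  by (simp add: coord_reflection_def inner_diff_left dot_square_norm algebra_simps)

lemma coord_reflection_norm: "norm e = 1 \<Longrightarrow> norm (coord_reflection e x) = norm x"
  using coord_reflection_inner[of e x x] by (simp add: norm_eq_sqrt_inner)

lemma coord_reflection_measurable: "coord_reflection (e::'a::euclidean_space) \<in> borel_measurable borel"
  unfolding coord_reflection_def[abs_def] by measurable

lemma distr_radial_law_coord_reflection:
  fixes e :: "'a::euclidean_space"
  assumes q: "admissible TYPE('a) q" and e: "e \<in> Basis"
  shows "distr (radial_law q) borel (coord_reflection e) = radial_law q"
proof -
  note [measurable] = radial_density_measurable[OF q] coord_reflection_measurable
  let ?c = "\<lambda>j::'a. if j = e then -1 else 1 :: real"
  have T: "0 + (\<Sum>j\<in>Basis. (?c j * (x \<bullet> j)) *\<^sub>R j) = coord_reflection e x" for x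
  proof (rule euclidean_eqI)
    fix i :: 'a assume i: "i \<in> Basis"
    show "(0 + (\<Sum>j\<in>Basis. (?c j * (x \<bullet> j)) *\<^sub>R j)) \<bullet> i = coord_reflection e x \<bullet> i"
      using i e by (auto simp: coord_reflection_def inner_diff_left inner_Basis)
  qed
  have lb: "lborel = distr lborel borel (coord_reflection e)"
    using lborel_affine_euclidean[of ?c 0] unfolding T
    by (auto simp: density_1 if_distrib cong: if_cong)
  have "radial_law q = density (distr lborel borel (coord_reflection e)) (\<lambda>w. ennreal (radial_density q w))"
    using lb by (simp add: radial_law_def)
  also have "\<dots> = distr (density lborel (\<lambda>w. ennreal (radial_density q (coord_reflection e w)))) borel
                     (coord_reflection e)"
    by (rule density_distr) measurable
  also have "\<dots> = distr (radial_law q) borel (coord_reflection e)"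
    using e by (simp add: radial_law_def radial_density_def coord_reflection_norm)
  finally show ?thesis by simp
qed

text \<open>
  An isometry that permutes \<open>V\<close> permutes its normal cones accordingly, so that no angle has to be
  computed to see that symmetric vertices have equal weight.
\<close>
lemma measure_open_normal_cone_reflection:
  fixes e :: "'a::euclidean_space"
  assumes q: "admissible TYPE('a) q" and e: "e \<in> Basis" and V: "finite V"
    and sym: "coord_reflection e ` V = V"
  shows "measure (radial_law q) (open_normal_cone V (coord_reflection e v))
       = measure (radial_law q) (open_normal_cone V v)"
proof -
  let ?r = "coord_reflection e"
  have n: "norm e = 1" using e by simp
  have inj: "?r x = ?r y \<longleftrightarrow> x = y" for x y
    using coord_reflection_involution[OF n] by metis
  have sub: "V - {?r v} = ?r ` (V - {v})"
  proof -
    have "?r ` (V - {v}) = ?r ` V - ?r ` {v}"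
      using inj by (intro image_set_diff) (simp add: inj_def)
    then show ?thesis by (simp add: sym)
  qed
  have "open_normal_cone V v = ?r -` open_normal_cone V (?r v)"
    unfolding open_normal_cone_def sub
    by (auto simp: coord_reflection_diff[symmetric] coord_reflection_inner[OF n])
  moreover have "measure (distr (radial_law q) borel ?r) (open_normal_cone V (?r v))
      = measure (radial_law q) (?r -` open_normal_cone V (?r v) \<inter> space (radial_law q))"
    using open_open_normal_cone[OF V] coord_reflection_measurable
    by (intro measure_distr) (auto simp: measurable_def)
  ultimately show ?thesis by (simp add: distr_radial_law_coord_reflection[OF q e])
qed

section \<open>The large noise limit\<close>

text \<open>
  The exceptional directions lie on the finitely many hyperplanes orthogonal to differences of
  points of \<open>V\<close>.
\<close>
lemma AE_open_normal_cone:
  fixes V :: "'a::euclidean_space set"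
  assumes q: "admissible TYPE('a) q" and V: "finite V" "V \<noteq> {}"
  shows "AE w in radial_law q. \<exists>v\<in>V. w \<in> open_normal_cone V v"
proof -
  have "AE w in radial_law q. \<forall>p\<in>V \<times> V. fst p \<noteq> snd p \<longrightarrow> w \<bullet> (fst p - snd p) \<noteq> 0"
  proof (rule AE_finite_allI)
    fix p assume "p \<in> V \<times> V"
    show "AE w in radial_law q. fst p \<noteq> snd p \<longrightarrow> w \<bullet> (fst p - snd p) \<noteq> 0"
      using AE_radial_law_not_orthogonal[OF q, of "fst p - snd p"] by (cases "fst p = snd p") auto
  qed (use V in auto)
  then show ?thesis
  proof eventually_elim
    case (elim w)
    then show ?case using V by (intro open_normal_cones_cover) auto
  qed
qed

lemma sum_measure_open_normal_cone:
  fixes V :: "'a::euclidean_space set"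
  assumes q: "admissible TYPE('a) q" and V: "finite V" "V \<noteq> {}"
  shows "(\<Sum>v\<in>V. measure (radial_law q) (open_normal_cone V v)) = 1"
proof -
  interpret prob_space "radial_law q :: 'a measure" by (rule prob_space_radial_law[OF q])
  have "(\<Sum>v\<in>V. prob (open_normal_cone V v)) = prob (\<Union>v\<in>V. open_normal_cone V v)"
    using V open_open_normal_cone[OF V(1)] open_normal_cone_disjoint
    by (intro finite_measure_finite_Union[symmetric]) (auto simp: disjoint_family_on_def, blast)
  also have "\<dots> = 1"
    using AE_open_normal_cone[OF q V] V open_open_normal_cone[OF V(1)]
    by (subst prob_eq_1) (auto intro!: sets.finite_UN)
  finally show ?thesis .
qed

definition deep_region :: "'a::real_inner set \<Rightarrow> real \<Rightarrow> 'a set" where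
  "deep_region V c = (\<Union>v\<in>V. deep_normal_cone V c v)"

lemma deep_region_borel: "finite V \<Longrightarrow> deep_region V c \<in> sets borel"
  unfolding deep_region_def by (intro borel_closed closed_UN closed_deep_normal_cone ballI)

text \<open>
  As the margin shrinks to zero, the deep cones increase to the open cones, which carry all the
  mass.
\<close>
lemma measure_deep_region_tendsto:
  fixes V :: "'a::euclidean_space set"
  assumes q: "admissible TYPE('a) q" and V: "finite V" "V \<noteq> {}" and "c > 0"
  shows "((\<lambda>\<sigma>. measure (radial_law q) (deep_region V (c / \<sigma>))) \<longlongrightarrow> 1) at_top"
proof -
  interpret prob_space "radial_law q :: 'a measure" by (rule prob_space_radial_law[OF q])
  let ?A = "\<lambda>n. deep_region V (c / real (Suc n))"
  have anti: "deep_region V s \<subseteq> deep_region V t" if "t \<le> s" for s t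
    using deep_normal_cone_antimono[OF that] unfolding deep_region_def by blast
  have un: "w \<in> (\<Union>n. ?A n)" if "v \<in> V" "w \<in> open_normal_cone V v" for v w
  proof -
    have "\<exists>n. \<forall>u\<in>V - {v}. w \<bullet> (u - v) \<le> - (c / real (Suc n))"
    proof -
      have "(\<lambda>n. - (c / real (Suc n))) \<longlonglongrightarrow> 0"
        by real_asymp
      then have "\<forall>\<^sub>F n in sequentially. w \<bullet> (u - v) < - (c / real (Suc n))" if "u \<in> V - {v}" for u
        using that \<open>w \<in> _\<close> by (intro order_tendstoD(1)) (auto simp: open_normal_cone_def)
      then have "\<forall>\<^sub>F n in sequentially. \<forall>u\<in>V - {v}. w \<bullet> (u - v) < - (c / real (Suc n))"
        using V by (intro eventually_ball_finite) auto
      then obtain n where "\<forall>u\<in>V - {v}. w \<bullet> (u - v) < - (c / real (Suc n))"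
        using eventually_happens[of _ sequentially] by auto
      then show ?thesis by (intro exI[of _ n]) (auto intro: less_imp_le)
    qed
    then show ?thesis using that by (auto simp: deep_region_def deep_normal_cone_def)
  qed
  have "(\<lambda>n. prob (?A n)) \<longlonglongrightarrow> prob (\<Union>n. ?A n)"
    using \<open>c > 0\<close> V
    by (intro finite_Lim_measure_incseq) (auto intro!: monoI anti deep_region_borel divide_left_mono)
  also have "prob (\<Union>n. ?A n) = 1"
  proof -
    have "AE w in radial_law q. w \<in> (\<Union>n. ?A n)"
      using AE_open_normal_cone[OF q V] by eventually_elim (use un in blast)
    then show ?thesis
      using V by (subst prob_eq_1) (auto intro!: sets.countable_UN deep_region_borel)
  qed
  finally have lim: "(\<lambda>n. prob (?A n)) \<longlonglongrightarrow> 1" .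
  show ?thesis
  proof (rule order_tendstoI)
    fix a :: real assume "a < 1"
    then have "\<forall>\<^sub>F n in sequentially. a < prob (?A n)" by (rule order_tendstoD(1)[OF lim])
    then obtain n where n: "a < prob (?A n)"
      using eventually_happens[of _ sequentially] by auto
    show "\<forall>\<^sub>F \<sigma> in at_top. a < prob (deep_region V (c / \<sigma>))"
      using eventually_ge_at_top[of "real (Suc n)"]
    proof eventually_elim
      case (elim \<sigma>)
      have "prob (?A n) \<le> prob (deep_region V (c / \<sigma>))"
        using elim V \<open>c > 0\<close>
        by (intro finite_measure_mono anti) (auto intro!: divide_left_mono deep_region_borel)
      with n show ?case by simp
    qed
  next
    fix a :: real assume "1 < a"
    then show "\<forall>\<^sub>F \<sigma> in at_top. prob (deep_region V (c / \<sigma>)) < a"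
      by (intro always_eventually allI) (rule le_less_trans[OF prob_le_1])
  qed
qed

definition limit_risk :: "(real \<Rightarrow> real) \<Rightarrow> real \<Rightarrow> 'a::euclidean_space set \<Rightarrow> 'a \<Rightarrow> real" where
  "limit_risk q \<eta> V \<theta> =
     (\<Sum>v\<in>V. measure (radial_law q) (open_normal_cone V v) * ((1 / \<eta>) * norm (v - \<theta>) powr \<eta>))"

text \<open>
  On the deep region the loss and its limit agree exactly, for every \<open>\<theta>\<close>; elsewhere they differ
  by at most a common bound of both. So the error is bounded by a multiple, independent of
  \<open>\<theta>\<close>, of the probability of the complement of the deep region.
\<close>
theorem uniform_limit_radial_risk:
  fixes V :: "'a::euclidean_space set"
  assumes q: "admissible TYPE('a) q" and V: "finite V" "V \<noteq> {}" and \<eta>: "\<eta> > 0"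
  shows "uniform_limit (convex hull V) (\<lambda>\<sigma>. radial_risk q \<eta> \<sigma> (convex hull V)) (limit_risk q \<eta> V) at_top"
proof -
  interpret prob_space "radial_law q :: 'a measure" by (rule prob_space_radial_law[OF q])
  let ?H = "convex hull V"
  have H: "?H \<noteq> {}" "compact ?H" "convex ?H" "closed ?H"
    using V by (auto intro: finite_imp_compact_convex_hull compact_imp_closed)
  \<comment> \<open>The summand 1 keeps the margin positive when the polytope is a single point.\<close>
  define D where "D = diameter ?H + 1"
  have D0: "D > 0"
    using diameter_ge_0[OF compact_imp_bounded[OF H(2)]] by (simp add: D_def)
  have D: "norm (x - y) \<le> D" if "x \<in> ?H" "y \<in> ?H" for x y
    using diameter_bounded_bound[OF compact_imp_bounded[OF H(2)] that] by (simp add: D_def dist_norm)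
  define B where "B = (1 / \<eta>) * D powr \<eta>"
  have B: "B > 0" using D0 \<eta> by (simp add: B_def)
  let ?G = "\<lambda>\<sigma>. deep_region V (D\<^sup>2 / \<sigma>)"
  have G: "?G \<sigma> \<in> sets borel" for \<sigma> using V(1) by (rule deep_region_borel)
  have cone [measurable]: "open_normal_cone V v \<in> sets borel" for v
    using open_open_normal_cone[OF V(1)] by simp
  have key: "\<bar>radial_risk q \<eta> \<sigma> ?H \<theta> - limit_risk q \<eta> V \<theta>\<bar> \<le> B * (1 - prob (?G \<sigma>))"
    if \<sigma>: "\<sigma> > 0" and \<theta>: "\<theta> \<in> ?H" for \<sigma> \<theta>
  proof -
    let ?c = "\<lambda>v. (1 / \<eta>) * norm (v - \<theta>) powr \<eta>"
    let ?f = "\<lambda>w. ?c (closest_point ?H (\<theta> + \<sigma> *\<^sub>R w))"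
    let ?g = "\<lambda>w. \<Sum>v\<in>V. indicator (open_normal_cone V v) w * ?c v"
    have cB: "0 \<le> ?c v" "?c v \<le> B" if "v \<in> ?H" for v
      using \<eta> D[OF that \<theta>] by (auto simp: B_def intro!: divide_right_mono powr_mono2)
    have VH: "v \<in> ?H" if "v \<in> V" for v using that by (rule hull_inc)
    have f: "integrable (radial_law q) ?f"
      by (rule radial_risk_well_defined(1)[OF q H(1-3) \<eta> \<theta>])
    have g: "integrable (radial_law q) ?g"
      by (intro Bochner_Integration.integrable_sum integrable_mult_left integrable_real_indicator)
         (auto simp: emeasure_eq_measure)
    have int_g: "(LINT w|radial_law q. ?g w) = limit_risk q \<eta> V \<theta>"
      unfolding limit_risk_def
      by (subst Bochner_Integration.integral_sum)
         (auto intro!: integrable_mult_left integrable_real_indicator simp: emeasure_eq_measure)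
    have pw: "\<bar>?f w - ?g w\<bar> \<le> B * indicator (- ?G \<sigma>) w" for w
    proof (cases "w \<in> ?G \<sigma>")
      case True
      then obtain v where v: "v \<in> V" "w \<in> deep_normal_cone V (D\<^sup>2 / \<sigma>) v"
        by (auto simp: deep_region_def)
      have "closest_point ?H (\<theta> + \<sigma> *\<^sub>R w) = v"
        by (rule closest_point_deep_normal_cone[OF V(1) v(1) \<theta> \<sigma> D v(2)])
      moreover have "w \<in> open_normal_cone V v"
        using v deep_normal_cone_subset_open[of "D\<^sup>2 / \<sigma>" V v] D0 \<sigma> by auto
      then have "?g w = ?c v" by (rule sum_indicator_open_normal_cone[OF V(1) v(1)])
      ultimately show ?thesis using B by (auto simp: indicator_def)
    next
      case False
      have fw: "0 \<le> ?f w \<and> ?f w \<le> B"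
        using cB[OF closest_point_in_set[OF H(4,1)]] by blast
      have gw: "0 \<le> ?g w \<and> ?g w \<le> B"
      proof (cases "\<exists>v\<in>V. w \<in> open_normal_cone V v")
        case True
        then obtain v where v: "v \<in> V" "w \<in> open_normal_cone V v" by blast
        then show ?thesis
          using sum_indicator_open_normal_cone[OF V(1) v, of ?c] cB[OF VH[OF v(1)]] by simp
      next
        case False
        then have "?g w = 0" by (intro sum.neutral) (auto simp: indicator_def)
        then show ?thesis using B by simp
      qed
      show ?thesis using fw gw False by (simp add: indicator_def abs_le_iff)
    qed
    have "radial_risk q \<eta> \<sigma> ?H \<theta> - limit_risk q \<eta> V \<theta> = (LINT w|radial_law q. ?f w - ?g w)"
      using Bochner_Integration.integral_diff[OF f g] unfolding int_g radial_risk_def by simp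
    then have "\<bar>radial_risk q \<eta> \<sigma> ?H \<theta> - limit_risk q \<eta> V \<theta>\<bar> = \<bar>LINT w|radial_law q. ?f w - ?g w\<bar>"
      by simp
    also have "\<dots> \<le> (LINT w|radial_law q. \<bar>?f w - ?g w\<bar>)"
      by (rule integral_abs_bound)
    also have "\<dots> \<le> (LINT w|radial_law q. B * indicator (- ?G \<sigma>) w)"
    proof (rule integral_mono)
      show "integrable (radial_law q) (\<lambda>w. \<bar>?f w - ?g w\<bar>)"
        by (rule integrable_abs[OF Bochner_Integration.integrable_diff[OF f g]])
      show "integrable (radial_law q) (\<lambda>w. B * indicator (- ?G \<sigma>) w)"
        using G by (intro integrable_mult_right integrable_real_indicator)
          (auto simp: emeasure_eq_measure)
    qed (rule pw)
    also have "\<dots> = B * prob (- ?G \<sigma>)" by simp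
    also have "prob (- ?G \<sigma>) = 1 - prob (?G \<sigma>)"
      using prob_compl[of "?G \<sigma>"] G by (simp add: Compl_eq_Diff_UNIV)
    finally show ?thesis .
  qed
  have "((\<lambda>\<sigma>. B * (1 - prob (?G \<sigma>))) \<longlongrightarrow> B * (1 - 1)) at_top"
    using D0 by (intro tendsto_intros measure_deep_region_tendsto[OF q V]) auto
  then have lim: "((\<lambda>\<sigma>. B * (1 - prob (?G \<sigma>))) \<longlongrightarrow> 0) at_top" by simp
  show ?thesis
  proof (rule uniform_limitI)
    fix \<epsilon> :: real assume "\<epsilon> > 0"
    then have "\<forall>\<^sub>F \<sigma> in at_top. B * (1 - prob (?G \<sigma>)) < \<epsilon>" by (rule order_tendstoD(2)[OF lim])
    then show "\<forall>\<^sub>F \<sigma> in at_top. \<forall>\<theta>\<in>?H. dist (radial_risk q \<eta> \<sigma> ?H \<theta>) (limit_risk q \<eta> V \<theta>) < \<epsilon>"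
      using eventually_gt_at_top[of 0]
    proof eventually_elim
      case (elim \<sigma>)
      then show ?case using key[of \<sigma>] by (fastforce simp: dist_real_def)
    qed
  qed
qed

text \<open>
  A nondecreasing convex function of a norm is convex. The case of a base equal to \<open>0\<close> is treated
  apart because \<open>powr_convex\<close> concerns positive bases.
\<close>
lemma convex_on_norm_diff_powr:
  fixes v :: "'a::real_normed_vector"
  assumes "p \<ge> 1"
  shows "convex_on UNIV (\<lambda>x. norm (v - x) powr p)"
proof -
  have pw: "(s * a + t * b) powr p \<le> s * a powr p + t * b powr p"
    if ab: "a \<ge> 0" "b \<ge> 0" "s \<ge> 0" "t \<ge> 0" "s + t = 1" for a b s t :: real
  proof -
    have z: "(r * x) powr p \<le> r * x powr p" if "0 \<le> r" "r \<le> 1" "x \<ge> 0" for r x :: real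
    proof -
      have "r powr p \<le> r powr 1"
        using that assms powr_mono'[of 1 p r] by (cases "r = 0") auto
      then show ?thesis using that by (simp add: powr_mult mult_right_mono)
    qed
    consider "a > 0" "b > 0" | "a = 0" | "b = 0" using ab by force
    then show ?thesis
    proof cases
      case 1
      then show ?thesis
        using powr_convex[OF assms] ab unfolding convex_on_def by simp
    next
      case 2
      then show ?thesis using z[of t b] ab by simp
    next
      case 3
      then show ?thesis using z[of s a] ab by simp
    qed
  qed
  show ?thesis
  proof (rule convex_onI)
    fix t :: real and x y :: 'a assume t: "0 < t" "t < 1"
    have "norm (v - ((1 - t) *\<^sub>R x + t *\<^sub>R y)) \<le> (1 - t) * norm (v - x) + t * norm (v - y)"
      using convex_onD[OF convex_on_dist[OF convex_UNIV, of v], of t x y] t by (simp add: dist_norm)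
    then have "norm (v - ((1 - t) *\<^sub>R x + t *\<^sub>R y)) powr p
             \<le> ((1 - t) * norm (v - x) + t * norm (v - y)) powr p"
      using assms by (intro powr_mono2) auto
    also have "\<dots> \<le> (1 - t) * norm (v - x) powr p + t * norm (v - y) powr p"
      using t by (intro pw) auto
    finally show "norm (v - ((1 - t) *\<^sub>R x + t *\<^sub>R y)) powr p
             \<le> (1 - t) * norm (v - x) powr p + t * norm (v - y) powr p" .
  qed simp
qed

lemma limit_risk_le_of_vertices:
  fixes V :: "'a::euclidean_space set"
  assumes "\<eta> \<ge> 1" "\<And>v. v \<in> V \<Longrightarrow> limit_risk q \<eta> V v \<le> b" "\<theta> \<in> convex hull V"
  shows "limit_risk q \<eta> V \<theta> \<le> b"
proof -
  have "convex_on UNIV (limit_risk q \<eta> V)"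
  proof (cases "finite V")
    case True
    have "convex_on UNIV (\<lambda>\<theta>. \<Sum>v\<in>W. measure (radial_law q) (open_normal_cone V v) * ((1 / \<eta>) * norm (v - \<theta>) powr \<eta>))"
      if "finite W" for W :: "'a set"
      using that
    proof induction
      case empty
      then show ?case by (simp add: convex_on_const)
    next
      case (insert v W)
      have "convex_on UNIV (\<lambda>\<theta>. measure (radial_law q) (open_normal_cone V v) * ((1 / \<eta>) * norm (v - \<theta>) powr \<eta>))"
        using assms(1) by (intro convex_on_cmul convex_on_norm_diff_powr) auto
      from convex_on_add[OF this insert.IH] show ?case using insert by simp
    qed
    from this[OF True] show ?thesis by (simp add: limit_risk_def[abs_def])
  qed (simp add: limit_risk_def[abs_def] convex_on_const)
  then have "convex_on (convex hull V) (limit_risk q \<eta> V)"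
    by (rule convex_on_subset) auto
  from convex_on_convex_hull_bound[OF this, of b] assms(2,3) show ?thesis by blast
qed


section \<open>A segment and a flat isosceles triangle\<close>

lemma uminus_Basis_neq:
  fixes e :: "'a::euclidean_space"
  assumes "e \<in> Basis"
  shows "- e \<noteq> e"
proof
  assume "- e = e"
  then have "(- e) \<bullet> e = e \<bullet> e" by (rule arg_cong)
  then show False using assms by simp
qed

lemma coord_reflection_pair:
  fixes e :: "'a::euclidean_space"
  assumes "e \<in> Basis"
  shows "coord_reflection e e = - e" "coord_reflection e (- e) = e"
  using assms by (simp_all add: coord_reflection_def algebra_simps scaleR_2)

lemma limit_risk_segment:
  fixes e :: "'a::euclidean_space"
  assumes q: "admissible TYPE('a) q" and e: "e \<in> Basis"
  shows "limit_risk q \<eta> {- e, e} (- e) = (1 / \<eta>) * (2 powr \<eta> / 2)"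
proof -
  let ?P = "\<lambda>v. measure (radial_law q) (open_normal_cone {- e, e} v)"
  have ne: "- e \<noteq> e" using e by (intro uminus_Basis_neq)
  have "coord_reflection e ` {- e, e} = {- e, e}"
    using coord_reflection_pair[OF e] by auto
  then have "?P e = ?P (- e)"
    using measure_open_normal_cone_reflection[OF q e, of "{- e, e}" e] coord_reflection_pair[OF e] by simp
  moreover have "?P e + ?P (- e) = 1"
    using sum_measure_open_normal_cone[OF q, of "{- e, e}"] ne by simp
  ultimately have half: "?P e = 1 / 2" by simp
  have "norm (e + e) = 2" using e by (simp flip: scaleR_2)
  then have "limit_risk q \<eta> {- e, e} (- e) = ?P e * ((1 / \<eta>) * 2 powr \<eta>)"
    using ne by (simp add: limit_risk_def)
  then show ?thesis by (simp only: half) simp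
qed

text \<open>
  With \<open>a\<close> the weight of each base vertex, \<open>p\<close> that of the apex, \<open>m = 2\<^sup>\<eta> / 2\<close>, and \<open>r < m\<close>
  the \<open>\<eta>\<close>-th power of the length of a leg, the total weight is \<open>2 a + p = 1\<close>.
  Up to the factor \<open>1 / \<eta>\<close>, the limiting risk is \<open>2 a m + p r\<close> at a base vertex, an average of \<open>m\<close> and \<open>r\<close> with positive weight on \<open>r\<close>, and it is
  \<open>2 a r \<le> r\<close> at the apex.
\<close>
lemma limit_risk_triangle:
  fixes e f :: "'a::euclidean_space"
  assumes q: "admissible TYPE('a) q" and e: "e \<in> Basis" "f \<in> Basis" "e \<noteq> f"
    and h: "h > 0" "sqrt (1 + h\<^sup>2) powr \<eta> < 2 powr \<eta> / 2" and \<eta>: "\<eta> > 0"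
    and v: "v \<in> {- e, e, h *\<^sub>R f}"
  shows "limit_risk q \<eta> {- e, e, h *\<^sub>R f} v < (1 / \<eta>) * (2 powr \<eta> / 2)"
proof -
  let ?V = "{- e, e, h *\<^sub>R f}"
  let ?P = "\<lambda>v. measure (radial_law q) (open_normal_cone ?V v)"
  define a where "a = ?P e"
  define p where "p = ?P (h *\<^sub>R f)"
  define m where "m = 2 powr \<eta> / (2::real)"
  define r where "r = sqrt (1 + h\<^sup>2) powr \<eta>"
  have ip: "e \<bullet> f = 0" "f \<bullet> e = 0" "e \<bullet> e = 1" "f \<bullet> f = 1"
    using e by (auto simp: inner_Basis)
  have ne: "- e \<noteq> e" "e \<noteq> h *\<^sub>R f" "- e \<noteq> h *\<^sub>R f"
  proof -
    show "- e \<noteq> e" using e by (intro uminus_Basis_neq)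
    have "e \<bullet> e \<noteq> (h *\<^sub>R f) \<bullet> e" "(- e) \<bullet> e \<noteq> (h *\<^sub>R f) \<bullet> e" by (simp_all add: ip)
    then show "e \<noteq> h *\<^sub>R f" "- e \<noteq> h *\<^sub>R f" by metis+
  qed
  have "coord_reflection e (h *\<^sub>R f) = h *\<^sub>R f"
    by (simp add: coord_reflection_def ip)
  then have "coord_reflection e ` ?V = ?V"
    using coord_reflection_pair[OF e(1)] by auto
  then have a': "?P (- e) = a"
    using measure_open_normal_cone_reflection[OF q e(1), of ?V e] coord_reflection_pair[OF e(1)]
    by (simp add: a_def)
  have sum1: "2 * a + p = 1"
    using sum_measure_open_normal_cone[OF q, of ?V] ne a' by (simp add: a_def p_def)
  have "f \<in> open_normal_cone ?V (h *\<^sub>R f)"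
    using h by (auto simp: open_normal_cone_def inner_diff_right ip)
  then have p: "p > 0"
    unfolding p_def by (intro radial_law_open_pos[OF q] open_open_normal_cone) auto
  have a0: "a \<ge> 0" by (simp add: a_def)
  have nrm: "norm (h *\<^sub>R f + e) = sqrt (1 + h\<^sup>2)" "norm (h *\<^sub>R f - e) = sqrt (1 + h\<^sup>2)"
    "norm (e - h *\<^sub>R f) = sqrt (1 + h\<^sup>2)" "norm (- e - h *\<^sub>R f) = sqrt (1 + h\<^sup>2)"
    "norm (e + e) = 2" "norm (- e - e) = 2"
    by (simp_all add: norm_eq_sqrt_inner inner_add_left inner_add_right inner_diff_left inner_diff_right
        ip power2_eq_square add.commute)
  have base: "2 * a * m + p * r < m"
  proof -
    have "p * r < p * m" using p h by (simp add: r_def m_def)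
    moreover have "2 * a * m + p * m = m" using sum1 by (metis distrib_right mult_1)
    ultimately show ?thesis by linarith
  qed
  have apex: "2 * a * r < m"
  proof -
    have "2 * a * r \<le> 1 * r" using sum1 p by (intro mult_right_mono) (auto simp: r_def)
    then show ?thesis using h by (simp add: r_def m_def)
  qed
  have m2: "2 powr \<eta> = 2 * m" by (simp add: m_def)
  have "\<eta> * limit_risk q \<eta> ?V v < m"
    using v
  proof (elim insertE emptyE)
    assume "v = - e"
    then have "\<eta> * limit_risk q \<eta> ?V v = 2 * a * m + p * r"
      using ne \<eta> nrm by (simp add: limit_risk_def a' m2 field_simps flip: a_def p_def r_def)
    with base show ?thesis by simp
  next
    assume "v = e"
    then have "\<eta> * limit_risk q \<eta> ?V v = 2 * a * m + p * r"
      using ne \<eta> nrm by (simp add: limit_risk_def a' m2 field_simps flip: a_def p_def r_def)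
    with base show ?thesis by simp
  next
    assume "v = h *\<^sub>R f"
    then have "\<eta> * limit_risk q \<eta> ?V v = 2 * a * r"
      using ne \<eta> nrm by (simp add: limit_risk_def a' field_simps flip: a_def p_def r_def)
    with apex show ?thesis by simp
  qed
  then show ?thesis using \<eta> by (simp add: m_def field_simps)
qed

text \<open>
  At \<open>h = 0\<close> the inequality reads \<open>1 < 2\<^sup>\<eta> / 2\<close>; this is where \<open>\<eta> > 1\<close> enters.
\<close>
lemma small_height_exists:
  fixes \<eta> :: real
  assumes "\<eta> > 1"
  shows "\<exists>h>0. sqrt (1 + h\<^sup>2) powr \<eta> < 2 powr \<eta> / 2"
proof -
  define m where "m = 2 powr \<eta> / (2::real)"
  have "2 powr 1 < 2 powr \<eta>" using assms by (intro powr_less_mono) auto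
  then have m: "m > 1" by (simp add: m_def)
  have "((\<lambda>h. sqrt (1 + h\<^sup>2) powr \<eta>) \<longlongrightarrow> sqrt (1 + 0\<^sup>2) powr \<eta>) (at_right 0)"
    by (intro tendsto_intros) auto
  then have "\<forall>\<^sub>F h in at_right 0. sqrt (1 + h\<^sup>2) powr \<eta> < m"
    using m by (intro order_tendstoD(2)) auto
  moreover have "\<forall>\<^sub>F h :: real in at_right 0. h > 0"
    by (rule eventually_at_right_less)
  ultimately have "\<forall>\<^sub>F h in at_right 0. h > 0 \<and> sqrt (1 + h\<^sup>2) powr \<eta> < m"
    by eventually_elim simp
  then show ?thesis
    using eventually_happens[of _ "at_right (0::real)"] by (auto simp: m_def)
qed

theorem theorem2p13:
  fixes q :: "real \<Rightarrow> real" and \<eta> :: real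
  assumes "admissible TYPE(real^2) q" and "\<eta> > 1"
  shows "\<exists>(\<Theta>S :: (real^2) set) (\<Theta>L :: (real^2) set) (\<sigma>1 :: real).
           \<Theta>S \<noteq> {} \<and> compact \<Theta>S \<and> convex \<Theta>S \<and>
           \<Theta>L \<noteq> {} \<and> compact \<Theta>L \<and> convex \<Theta>L \<and>
           \<Theta>S \<subset> \<Theta>L \<and> \<sigma>1 > 0 \<and>
           (\<forall>\<sigma>\<ge>\<sigma>1. (SUP \<theta>\<in>\<Theta>S. radial_risk q \<eta> \<sigma> \<Theta>S \<theta>)
                    > (SUP \<theta>\<in>\<Theta>L. radial_risk q \<eta> \<sigma> \<Theta>L \<theta>))"
proof -
  note q = assms(1)
  have \<eta>: "\<eta> > 0" "\<eta> \<ge> 1" using assms(2) by auto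
  obtain h where h: "h > 0" "sqrt (1 + h\<^sup>2) powr \<eta> < 2 powr \<eta> / 2"
    using small_height_exists[OF assms(2)] by blast
  define e f :: "real^2" where "e = axis 1 1" and "f = axis 2 1"
  have ef: "e \<in> Basis" "f \<in> Basis" "e \<noteq> f"
    by (auto simp: e_def f_def axis_eq_axis axis_in_Basis_iff)
  define S L where "S = {- e, e}" and "L = {- e, e, h *\<^sub>R f}"
  have fin: "finite S" "finite L" "S \<noteq> {}" "L \<noteq> {}" by (auto simp: S_def L_def)
  define g where "g = (1 / \<eta>) * (2 powr \<eta> / 2)"
  define b where "b = Max (limit_risk q \<eta> L ` L)"
  have "b \<in> limit_risk q \<eta> L ` L" unfolding b_def using fin by (intro Max_in) auto
  then have bg: "b < g"
    using limit_risk_triangle[OF q ef h \<eta>(1)] by (auto simp: g_def L_def)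
  \<comment> \<open>Both risks may err by \<open>\<epsilon>\<close>, so a third of the gap leaves a strict inequality.\<close>
  define \<epsilon> where "\<epsilon> = (g - b) / 3"
  have \<epsilon>: "\<epsilon> > 0" using bg by (simp add: \<epsilon>_def)
  have "\<forall>\<^sub>F \<sigma> in at_top.
      (\<forall>\<theta>\<in>convex hull S. dist (radial_risk q \<eta> \<sigma> (convex hull S) \<theta>) (limit_risk q \<eta> S \<theta>) < \<epsilon>) \<and>
      (\<forall>\<theta>\<in>convex hull L. dist (radial_risk q \<eta> \<sigma> (convex hull L) \<theta>) (limit_risk q \<eta> L \<theta>) < \<epsilon>)"
    using uniform_limitD[OF uniform_limit_radial_risk[OF q fin(1,3) \<eta>(1)] \<epsilon>]
      uniform_limitD[OF uniform_limit_radial_risk[OF q fin(2,4) \<eta>(1)] \<epsilon>]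
    by (rule eventually_conj)
  then obtain \<sigma>0 where \<sigma>0: "\<And>\<sigma> \<theta>. \<sigma> \<ge> \<sigma>0 \<Longrightarrow> \<theta> \<in> convex hull S \<Longrightarrow>
        dist (radial_risk q \<eta> \<sigma> (convex hull S) \<theta>) (limit_risk q \<eta> S \<theta>) < \<epsilon>"
      "\<And>\<sigma> \<theta>. \<sigma> \<ge> \<sigma>0 \<Longrightarrow> \<theta> \<in> convex hull L \<Longrightarrow>
        dist (radial_risk q \<eta> \<sigma> (convex hull L) \<theta>) (limit_risk q \<eta> L \<theta>) < \<epsilon>"
    unfolding eventually_at_top_linorder by blast
  have comp: "compact (convex hull S)" "compact (convex hull L)"
    using fin by (auto intro: finite_imp_compact_convex_hull)
  have sup: "(SUP \<theta>\<in>convex hull L. radial_risk q \<eta> \<sigma> (convex hull L) \<theta>)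
      < (SUP \<theta>\<in>convex hull S. radial_risk q \<eta> \<sigma> (convex hull S) \<theta>)" if "\<sigma> \<ge> max 1 \<sigma>0" for \<sigma>
  proof -
    have "(SUP \<theta>\<in>convex hull L. radial_risk q \<eta> \<sigma> (convex hull L) \<theta>) \<le> b + \<epsilon>"
    proof (rule cSUP_least)
      fix \<theta> assume \<theta>: "\<theta> \<in> convex hull L"
      have "limit_risk q \<eta> L \<theta> \<le> b"
        using fin by (intro limit_risk_le_of_vertices[OF \<eta>(2) _ \<theta>]) (simp add: b_def)
      then show "radial_risk q \<eta> \<sigma> (convex hull L) \<theta> \<le> b + \<epsilon>"
        using \<sigma>0(2)[of \<sigma> \<theta>] \<theta> that by (auto simp: dist_real_def)
    qed (use fin in auto)
    also have "\<dots> < g - \<epsilon>" using bg by (simp add: \<epsilon>_def field_simps)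
    also have "\<dots> \<le> radial_risk q \<eta> \<sigma> (convex hull S) (- e)"
      using \<sigma>0(1)[of \<sigma> "- e"] that limit_risk_segment[OF q ef(1), of \<eta>]
      by (auto simp: dist_real_def g_def S_def hull_inc)
    also have "\<dots> \<le> (SUP \<theta>\<in>convex hull S. radial_risk q \<eta> \<sigma> (convex hull S) \<theta>)"
      using radial_risk_well_defined(2)[OF q _ comp(1) _ \<eta>(1)] fin
      by (intro cSUP_upper) (auto simp: S_def hull_inc)
    finally show ?thesis .
  qed
  have "convex hull S \<subset> convex hull L"
  proof
    show "convex hull S \<subseteq> convex hull L" by (intro hull_mono) (auto simp: S_def L_def)
    have "convex hull S \<subseteq> {z. f \<bullet> z = 0}"
      using ef by (intro hull_minimal convex_hyperplane) (auto simp: S_def inner_Basis)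
    moreover have "h *\<^sub>R f \<in> convex hull L" by (simp add: L_def hull_inc)
    moreover have "f \<bullet> (h *\<^sub>R f) \<noteq> 0" using ef h by simp
    ultimately show "convex hull S \<noteq> convex hull L" by blast
  qed
  then show ?thesis
    using sup comp fin
    by (intro exI[of _ "convex hull S"] exI[of _ "convex hull L"] exI[of _ "max 1 \<sigma>0"]) auto
qed

end
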